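(* Let $\mathbb{G}\in\{\mathbb{Z},\mathbb{Z}_+\}$. There exists a compact self-adjoint operator $V=V_0+SV_1+V_1^*S^*$ on $\mathcal{H}_{\mathbb{G}}=\ell^2(\mathbb{G};\mathbb{C}^2)$, with $V_0,V_1\in\ell^\infty(\mathbb{G};M_2(\mathbb{C}))$, such that $V_1^{11}=V_1^{12}=V_1^{22}=0$, $V_0^{12}(n)\ne-1$ and $V_1^{21}(n)\neq1$ for all $n\in\mathbb{G}$, and such that $V_0=V_0^*$, $\lim_{|n|\to\infty}\|V_j(n)\|=0$ and $V_j\in\mathcal{S}(\mathbb{G})+\mathcal{M}_1(\mathbb{G})+\mathcal{Q}_{1,2}(\mathbb{G})$ for $j=0,1$, but for which there do not exist integers $p_1,p_2\ge1$ such that $$V_0^{jj}|_{\mathbb{Z}_+}-\tau^{p_1}\left(V_0^{jj}|_{\mathbb{Z}_+}\right)\in\ell^1(\mathbb{Z}_+;\mathbb{R})\quad\text{and}\quad V_l^{21}|_{\mathbb{Z}_+}-\tau^{p_2}\left(V_l^{21}|_{\mathbb{Z}_+}\right)\in\ell^1(\mathbb{Z}_+;\mathbb{C})$$ hold for all $j=1,2$ and $l=0,1$.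
   Context: $\mathbb{Z}_+$ is the set of non-negative integers. $S$ is the right shift, $(Su)(n)=u(n-1)$, except that $(Su)(0)=0$ when $\mathbb{G}=\mathbb{Z}_+$, acting componentwise on $\mathcal{H}_{\mathbb{G}}$. A sequence $W=(W^{ij})_{i,j=1,2}\in\ell^\infty(\mathbb{G};M_2(\mathbb{C}))$ is identified with the multiplication operator $(Wu)(n)=W(n)u(n)$; $W^*$ is the sequence $(W(n)^* )_n$; $\|\cdot\|$ is a matrix norm. For an integer $p\ge1$ and a (scalar or matrix-valued) sequence $W$ on $\mathbb{G}$, $(\tau^pW)(n):=W(n-p)$, except that $(\tau^pW)(n):=0$ if $\mathbb{G}=\mathbb{Z}_+$ and $n<p$; when applied to the restrictions $V_0^{jj}|_{\mathbb{Z}_+}$ and $V_l^{21}|_{\mathbb{Z}_+}$, $\tau^p$ acts on sequences indexed by $\mathbb{Z}_+$. Fix $0<\beta<\gamma<\infty$ (the sets below do not depend on this choice); the supremum over the empty set is $0$ and suprema are over $n\in\mathbb{G}$. Define $$\mathcal{S}(\mathbb{G}):=\left\{W\in\ell^\infty(\mathbb{G};M_2(\mathbb{C})):\int_1^\infty\sup_{\beta r<|n|<\gamma r}\|W(n)\|\,dr<\infty\right\},$$ $$\mathcal{M}_1(\mathbb{G}):=\left\{W\in\ell^\infty(\mathbb{G};M_2(\mathbb{C})):\int_1^\infty\sup_{\beta r<|n|<\gamma r}\|(\tau W-W)(n)\|\,dr<\infty\right\},$$ $$\mathcal{Q}_{1,2}(\mathbb{G}):=\left\{W\in\ell^\infty(\mathbb{G};M_2(\mathbb{C})):\sup_{n}\|n(W-\tau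 W)(n)\|+\sup_n\|n^2(W-2\tau W+\tau^{2}W)(n)\|<\infty\right\}.$$ *)

theory Defs
  imports "HOL-Analysis.Analysis"
begin

text \<open>
  The index set \<open>G\<close> is a set of integers, in the applications \<open>UNIV\<close> or \<open>{0..}\<close>. A sequence on
  \<open>G\<close> is represented by a function on all integers that vanishes outside \<open>G\<close>.
\<close>

definition tau :: "int set \<Rightarrow> nat \<Rightarrow> (int \<Rightarrow> 'a::zero) \<Rightarrow> int \<Rightarrow> 'a" where
  "tau G p W = (\<lambda>n. if n \<in> G \<and> n - int p \<in> G then W (n - int p) else 0)"

definition restr :: "int set \<Rightarrow> (int \<Rightarrow> 'a::zero) \<Rightarrow> int \<Rightarrow> 'a" where
  "restr G W = (\<lambda>n. if n \<in> G then W n else 0)"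

definition ell2 :: "int set \<Rightarrow> (int \<Rightarrow> complex^2) set" where
  "ell2 G = {u. (\<forall>n. n \<notin> G \<longrightarrow> u n = 0) \<and> (\<lambda>n. (norm (u n))\<^sup>2) summable_on G}"

definition ell2_inner :: "int set \<Rightarrow> (int \<Rightarrow> complex^2) \<Rightarrow> (int \<Rightarrow> complex^2) \<Rightarrow> complex" where
  "ell2_inner G u v = (\<Sum>\<^sub>\<infinity>n\<in>G. \<Sum>i\<in>UNIV. u n $ i * cnj (v n $ i))"

definition ell2_norm :: "int set \<Rightarrow> (int \<Rightarrow> complex^2) \<Rightarrow> real" where
  "ell2_norm G u = sqrt (\<Sum>\<^sub>\<infinity>n\<in>G. (norm (u n))\<^sup>2)"

definition ell2_dist :: "int set \<Rightarrow> (int \<Rightarrow> complex^2) \<Rightarrow> (int \<Rightarrow> complex^2) \<Rightarrow> real" where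
  "ell2_dist G u v = ell2_norm G (\<lambda>n. u n - v n)"

abbreviation ell2_topology :: "int set \<Rightarrow> (int \<Rightarrow> complex^2) topology" where
  "ell2_topology G \<equiv> Metric_space.mtopology (ell2 G) (ell2_dist G)"

text \<open>Only the values of an operator on \<open>ell2 G\<close> matter.\<close>

definition bounded_op :: "int set \<Rightarrow> ((int \<Rightarrow> complex^2) \<Rightarrow> (int \<Rightarrow> complex^2)) \<Rightarrow> bool" where
  "bounded_op G A \<longleftrightarrow>
     (\<forall>u\<in>ell2 G. A u \<in> ell2 G) \<and>
     (\<forall>u\<in>ell2 G. \<forall>v\<in>ell2 G. A (\<lambda>n. u n + v n) = (\<lambda>n. A u n + A v n)) \<and>
     (\<forall>c. \<forall>u\<in>ell2 G. A (\<lambda>n. c *s u n) = (\<lambda>n. c *s A u n)) \<and>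
     (\<exists>K. \<forall>u\<in>ell2 G. ell2_norm G (A u) \<le> K * ell2_norm G u)"

definition compact_op :: "int set \<Rightarrow> ((int \<Rightarrow> complex^2) \<Rightarrow> (int \<Rightarrow> complex^2)) \<Rightarrow> bool" where
  "compact_op G A \<longleftrightarrow>
     bounded_op G A \<and>
     compactin (ell2_topology G)
       (ell2_topology G closure_of (A ` {u \<in> ell2 G. ell2_norm G u \<le> 1}))"

definition is_adjoint_op ::
    "int set \<Rightarrow> ((int \<Rightarrow> complex^2) \<Rightarrow> (int \<Rightarrow> complex^2)) \<Rightarrow>
     ((int \<Rightarrow> complex^2) \<Rightarrow> (int \<Rightarrow> complex^2)) \<Rightarrow> bool" where
  "is_adjoint_op G A B \<longleftrightarrow>
     (\<forall>v\<in>ell2 G. B v \<in> ell2 G) \<and>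
     (\<forall>u\<in>ell2 G. \<forall>v\<in>ell2 G. ell2_inner G (A u) v = ell2_inner G u (B v))"

text \<open>On \<open>ell2 G\<close> the adjoint is unique; see \<open>is_adjoint_op_unique\<close> below.\<close>

definition adjoint_op ::
    "int set \<Rightarrow> ((int \<Rightarrow> complex^2) \<Rightarrow> (int \<Rightarrow> complex^2)) \<Rightarrow>
     ((int \<Rightarrow> complex^2) \<Rightarrow> (int \<Rightarrow> complex^2))" where
  "adjoint_op G A = (SOME B. is_adjoint_op G A B)"

definition self_adjoint_op ::
    "int set \<Rightarrow> ((int \<Rightarrow> complex^2) \<Rightarrow> (int \<Rightarrow> complex^2)) \<Rightarrow> bool" where
  "self_adjoint_op G A \<longleftrightarrow> bounded_op G A \<and> is_adjoint_op G A A"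

definition right_shift :: "int set \<Rightarrow> (int \<Rightarrow> complex^2) \<Rightarrow> (int \<Rightarrow> complex^2)" where
  "right_shift G u = tau G 1 u"

definition mult_op :: "(int \<Rightarrow> complex^2^2) \<Rightarrow> (int \<Rightarrow> complex^2) \<Rightarrow> (int \<Rightarrow> complex^2)" where
  "mult_op W u = (\<lambda>n. W n *v u n)"

definition adjoint_seq :: "(int \<Rightarrow> complex^2^2) \<Rightarrow> (int \<Rightarrow> complex^2^2)" where
  "adjoint_seq W = (\<lambda>n. \<chi> i j. cnj (W n $ j $ i))"

text \<open>
  The matrix norm is the norm of \<^typ>\<open>complex^2^2\<close>, i.e. the Frobenius norm. All norms on that
  space are equivalent, so the sets below do not depend on this choice. Suprema are taken in
  \<^typ>\<open>ennreal\<close>, where the supremum of the empty set is 0.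
\<close>

definition ell_infty :: "int set \<Rightarrow> (int \<Rightarrow> complex^2^2) set" where
  "ell_infty G = {W. (\<forall>n. n \<notin> G \<longrightarrow> W n = 0) \<and> bounded (W ` G)}"

definition ell1 :: "int set \<Rightarrow> complex set \<Rightarrow> (int \<Rightarrow> complex) set" where
  "ell1 G K = {x. (\<forall>n. n \<notin> G \<longrightarrow> x n = 0) \<and> (\<forall>n\<in>G. x n \<in> K) \<and>
     (\<lambda>n. norm (x n)) summable_on G}"

definition annulus :: "real \<Rightarrow> real \<Rightarrow> int set \<Rightarrow> real \<Rightarrow> int set" where
  "annulus \<beta> \<gamma> G r = {n \<in> G. \<beta> * r < \<bar>real_of_int n\<bar> \<and> \<bar>real_of_int n\<bar> < \<gamma> * r}"

definition class_S :: "real \<Rightarrow> real \<Rightarrow> int set \<Rightarrow> (int \<Rightarrow> complex^2^2) set" where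
  "class_S \<beta> \<gamma> G = {W \<in> ell_infty G.
     (\<integral>\<^sup>+r\<in>{1..}. (SUP n\<in>annulus \<beta> \<gamma> G r. ennreal (norm (W n))) \<partial>lborel) < \<infinity>}"

definition class_M1 :: "real \<Rightarrow> real \<Rightarrow> int set \<Rightarrow> (int \<Rightarrow> complex^2^2) set" where
  "class_M1 \<beta> \<gamma> G = {W \<in> ell_infty G.
     (\<integral>\<^sup>+r\<in>{1..}. (SUP n\<in>annulus \<beta> \<gamma> G r. ennreal (norm (tau G 1 W n - W n))) \<partial>lborel) < \<infinity>}"

definition class_Q12 :: "int set \<Rightarrow> (int \<Rightarrow> complex^2^2) set" where
  "class_Q12 G = {W \<in> ell_infty G.
     (SUP n\<in>G. ennreal (norm (real_of_int n *\<^sub>R (W n - tau G 1 W n)))) +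
     (SUP n\<in>G. ennreal (norm ((real_of_int n)\<^sup>2 *\<^sub>R
        (W n - 2 *\<^sub>R tau G 1 W n + tau G 2 W n)))) < \<infinity>}"

definition class_sum :: "real \<Rightarrow> real \<Rightarrow> int set \<Rightarrow> (int \<Rightarrow> complex^2^2) set" where
  "class_sum \<beta> \<gamma> G = {(\<lambda>n. X n + Y n + Z n) | X Y Z.
     X \<in> class_S \<beta> \<gamma> G \<and> Y \<in> class_M1 \<beta> \<gamma> G \<and> Z \<in> class_Q12 G}"

lemma ell2_add:
  assumes "u \<in> ell2 G" "v \<in> ell2 G"
  shows "(\<lambda>n. u n + v n) \<in> ell2 G"
proof -
  have "(\<lambda>n. 2 * (norm (u n))\<^sup>2 + 2 * (norm (v n))\<^sup>2) summable_on G"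
    using assms by (auto simp: ell2_def intro!: summable_on_add summable_on_cmult_right)
  moreover have "(norm (u n + v n))\<^sup>2 \<le> 2 * (norm (u n))\<^sup>2 + 2 * (norm (v n))\<^sup>2" for n
  proof -
    have "(norm (u n + v n))\<^sup>2 \<le> (norm (u n) + norm (v n))\<^sup>2"
      by (intro power_mono norm_triangle_ineq) auto
    also have "\<dots> \<le> 2 * (norm (u n))\<^sup>2 + 2 * (norm (v n))\<^sup>2"
      using zero_le_power2[of "norm (u n) - norm (v n)"]
      unfolding power2_diff power2_sum by linarith
    finally show ?thesis .
  qed
  ultimately have "(\<lambda>n. (norm (u n + v n))\<^sup>2) summable_on G"
    by (rule summable_on_comparison_test) auto
  then show ?thesis using assms by (auto simp: ell2_def)
qed

lemma ell2_minus: "u \<in> ell2 G \<Longrightarrow> (\<lambda>n. - u n) \<in> ell2 G"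
  by (auto simp: ell2_def)

lemma ell2_diff: "u \<in> ell2 G \<Longrightarrow> v \<in> ell2 G \<Longrightarrow> (\<lambda>n. u n - v n) \<in> ell2 G"
  using ell2_add[of u G "\<lambda>n. - v n"] ell2_minus[of v G] by simp

lemma ell2_norm_nonneg: "0 \<le> ell2_norm G u"
  by (auto simp: ell2_norm_def intro!: infsum_nonneg)

lemma L2_set_le_ell2_norm:
  assumes "u \<in> ell2 G" "finite F" "F \<subseteq> G"
  shows "L2_set (\<lambda>n. norm (u n)) F \<le> ell2_norm G u"
  using assms unfolding L2_set_def ell2_norm_def ell2_def
  by (auto intro!: finite_sum_le_infsum)

lemma ell2_norm_triangle:
  assumes "u \<in> ell2 G" "v \<in> ell2 G"
  shows "ell2_norm G (\<lambda>n. u n + v n) \<le> ell2_norm G u + ell2_norm G v"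
proof -
  let ?K = "ell2_norm G u + ell2_norm G v"
  have K: "0 \<le> ?K" by (simp add: ell2_norm_nonneg)
  have "(\<Sum>\<^sub>\<infinity>n\<in>G. (norm (u n + v n))\<^sup>2) \<le> ?K\<^sup>2"
  proof (rule infsum_le_finite_sums)
    show "(\<lambda>n. (norm (u n + v n))\<^sup>2) summable_on G"
      using ell2_add[OF assms] by (auto simp: ell2_def)
    fix F assume F: "finite F" "F \<subseteq> G"
    have "L2_set (\<lambda>n. norm (u n + v n)) F \<le> L2_set (\<lambda>n. norm (u n) + norm (v n)) F"
      by (rule L2_set_mono) (auto intro: norm_triangle_ineq)
    also have "\<dots> \<le> L2_set (\<lambda>n. norm (u n)) F + L2_set (\<lambda>n. norm (v n)) F"
      by (rule L2_set_triangle_ineq)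
    also have "\<dots> \<le> ?K"
      using L2_set_le_ell2_norm[OF assms(1) F] L2_set_le_ell2_norm[OF assms(2) F] by linarith
    finally have "sqrt (\<Sum>n\<in>F. (norm (u n + v n))\<^sup>2) \<le> ?K" by (simp add: L2_set_def)
    then show "(\<Sum>n\<in>F. (norm (u n + v n))\<^sup>2) \<le> ?K\<^sup>2"
      by (rule sqrt_le_D)
  qed
  then show ?thesis using K unfolding ell2_norm_def[of G "\<lambda>n. u n + v n"]
    by (rule real_le_lsqrt[rotated 1])
qed

lemma ell2_norm_eq_0_iff:
  assumes "u \<in> ell2 G"
  shows "ell2_norm G u = 0 \<longleftrightarrow> u = (\<lambda>_. 0)"
proof
  assume 0: "ell2_norm G u = 0"
  have "u n = 0" for n
  proof (cases "n \<in> G")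
    case True
    then show ?thesis using L2_set_le_ell2_norm[OF assms, of "{n}"] 0 by (simp add: L2_set_def)
  qed (use assms in \<open>auto simp: ell2_def\<close>)
  then show "u = (\<lambda>_. 0)" by auto
qed (simp add: ell2_norm_def)

lemma Metric_space_ell2: "Metric_space (ell2 G) (ell2_dist G)"
proof
  show "0 \<le> ell2_dist G u v" for u v by (simp add: ell2_dist_def ell2_norm_nonneg)
  show "ell2_dist G u v = ell2_dist G v u" for u v
    by (simp add: ell2_dist_def ell2_norm_def norm_minus_commute)
next
  fix u v assume "u \<in> ell2 G" "v \<in> ell2 G"
  then show "ell2_dist G u v = 0 \<longleftrightarrow> u = v"
    by (simp add: ell2_dist_def ell2_norm_eq_0_iff ell2_diff fun_eq_iff)
next
  fix u v w assume "u \<in> ell2 G" "v \<in> ell2 G" "w \<in> ell2 G"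
  then show "ell2_dist G u w \<le> ell2_dist G u v + ell2_dist G v w"
    unfolding ell2_dist_def
    using ell2_norm_triangle[of "\<lambda>n. u n - v n" G "\<lambda>n. v n - w n"] by (simp add: ell2_diff)
qed

lemma is_adjoint_op_unique:
  assumes B: "is_adjoint_op G A B" and C: "is_adjoint_op G A C" and v: "v \<in> ell2 G"
  shows "B v = C v"
proof (rule ext)
  fix n
  show "B v n = C v n"
  proof (cases "n \<in> G")
    case True
    have "B v n $ i = C v n $ i" for i
    proof -
      define e where "e = (\<lambda>m. if m = n then axis i (1::complex) else 0)"
      have e: "e \<in> ell2 G"
        using True unfolding ell2_def e_def
        by (auto intro!: finite_nonzero_values_imp_summable_on
              intro: finite_subset[of _ "{n}"] split: if_splits)
      have inn: "ell2_inner G e w = cnj (w n $ i)" for w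
      proof -
        have "ell2_inner G e w = (\<Sum>\<^sub>\<infinity>m\<in>{n}. \<Sum>j\<in>UNIV. e m $ j * cnj (w m $ j))"
          unfolding ell2_inner_def using True
          by (intro infsum_cong_neutral) (auto simp: e_def)
        also have "\<dots> = cnj (w n $ i)"
          by (simp add: e_def axis_def if_distrib[of "\<lambda>x. x * _"] cong: if_cong)
        finally show ?thesis .
      qed
      have "ell2_inner G e (B v) = ell2_inner G e (C v)"
        using B C v e unfolding is_adjoint_op_def by metis
      then show ?thesis by (simp add: inn)
    qed
    then show ?thesis by (simp add: vec_eq_iff)
  next
    case False
    then show ?thesis using B C v unfolding is_adjoint_op_def ell2_def by simp
  qed
qed

lemma adjoint_op_eq:
  assumes "is_adjoint_op G A B" "v \<in> ell2 G"
  shows "adjoint_op G A v = B v"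
  using is_adjoint_op_unique[OF someI[of "is_adjoint_op G A"]] assms
  unfolding adjoint_op_def by blast

lemma adjoint_right_shift:
  assumes G: "G \<in> {UNIV, {0..}}" and v: "v \<in> ell2 G"
  shows "adjoint_op G (right_shift G) v = (\<lambda>n. if n \<in> G then v (n + 1) else 0)"
proof -
  have succ: "n + 1 \<in> G" if "n \<in> G" for n using G that by auto
  have inj: "inj_on (\<lambda>n. n + 1) G" by (auto simp: inj_on_def)
  have sub: "(\<lambda>n. n + 1) ` G \<subseteq> G" using succ by auto
  have "is_adjoint_op G (right_shift G) (\<lambda>v n. if n \<in> G then v (n + 1) else 0)"
    unfolding is_adjoint_op_def
  proof (intro conjI ballI)
    fix v assume v: "v \<in> ell2 G"
    then have "(\<lambda>n. (norm (v n))\<^sup>2) summable_on (\<lambda>n. n + 1) ` G"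
      using sub summable_on_subset_banach by (auto simp: ell2_def)
    then have "(\<lambda>n. (norm (v (n + 1)))\<^sup>2) summable_on G"
      by (simp add: summable_on_reindex[OF inj] o_def)
    then have "(\<lambda>n. (norm (if n \<in> G then v (n + 1) else 0))\<^sup>2) summable_on G"
      by (rule summable_on_cong[THEN iffD1, rotated]) simp
    then show "(\<lambda>n. if n \<in> G then v (n + 1) else 0) \<in> ell2 G"
      by (simp add: ell2_def)
  next
    fix u v
    have "ell2_inner G (right_shift G u) v
        = (\<Sum>\<^sub>\<infinity>n\<in>(\<lambda>n. n + 1) ` G. \<Sum>i\<in>UNIV. u (n - 1) $ i * cnj (v n $ i))"
      unfolding ell2_inner_def right_shift_def tau_def
    proof (rule infsum_cong_neutral)
      fix n assume "n \<in> G - (\<lambda>n. n + 1) ` G"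
      then have "n - 1 \<notin> G" by force
      then show "(\<Sum>i\<in>UNIV. (if n \<in> G \<and> n - int 1 \<in> G then u (n - int 1) else 0) $ i
          * cnj (v n $ i)) = 0" by simp
    qed (use sub in auto)
    also have "\<dots> = (\<Sum>\<^sub>\<infinity>n\<in>G. \<Sum>i\<in>UNIV. u n $ i * cnj (v (n + 1) $ i))"
      by (simp add: infsum_reindex[OF inj] o_def)
    also have "\<dots> = ell2_inner G u (\<lambda>n. if n \<in> G then v (n + 1) else 0)"
      unfolding ell2_inner_def by (rule infsum_cong) simp
    finally show "ell2_inner G (right_shift G u) v
        = ell2_inner G u (\<lambda>n. if n \<in> G then v (n + 1) else 0)" .
  qed
  from adjoint_op_eq[OF this v] show ?thesis .
qed

end

theory Submission
  imports Defs "HOL-Real_Asymp.Real_Asymp"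
begin

text \<open>
  Take \<open>V1 = 0\<close> and \<open>V0(n) = f(n) E\<^sub>1\<^sub>1\<close> with \<open>f(n) = cos (\<pi> log\<^sub>2 n) / (1 + log\<^sub>2 n)\<close> for \<open>n \<ge> 1\<close> and
  \<open>f(n) = 0\<close> otherwise. Then \<open>f\<close> tends to 0, and since \<open>f\<close> is a function of \<open>log n\<close> with bounded
  first and second derivatives, \<open>V0\<close> lies in \<open>class_Q12 G\<close>. Along \<open>n = p 2\<^sup>k\<close> the value of \<open>f\<close> is
  \<open>(-1)\<^sup>k cos (\<pi> log\<^sub>2 p) / (1 + log\<^sub>2 p + k)\<close>, whose factor \<open>cos (\<pi> log\<^sub>2 p)\<close> is not 0 because
  \<open>p\<^sup>2\<close> is not an odd power of 2. So the variation of \<open>f\<close> along the multiples of \<open>p\<close> dominates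
  a divergent harmonic series, and \<open>f - \<tau>\<^sup>p f\<close> is not summable for any \<open>p \<ge> 1\<close>.
\<close>

section \<open>Multiplication operators on \<open>ell2 G\<close>: boundedness, self-adjointness,
  compactness\<close>

text \<open>The matrix norm here is the Frobenius norm: Cauchy-Schwarz bounds each entry by the norm
  of its row, and the rows are then combined in the 2-norm.\<close>

lemma norm_matrix_vector_mult_le:
  fixes A :: "complex^'n^'m" and x :: "complex^'n"
  shows "norm (A *v x) \<le> norm A * norm x"
proof -
  have "norm ((A *v x) $ i) \<le> norm (A $ i) * norm x" for i
  proof -
    have "norm ((A *v x) $ i) \<le> (\<Sum>j\<in>UNIV. norm (A $ i $ j * x $ j))"
      unfolding matrix_vector_mult_def by (simp add: norm_sum)
    also have "\<dots> \<le> norm (A $ i) * norm x"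
      unfolding norm_vec_def[of "A $ i"] norm_vec_def[of x]
      using L2_set_mult_ineq[of "\<lambda>j. norm (A $ i $ j)" "\<lambda>j. norm (x $ j)" UNIV]
      by (simp add: norm_mult)
    finally show ?thesis .
  qed
  then have "norm (A *v x) \<le> L2_set (\<lambda>i. norm (A $ i) * norm x) UNIV"
    unfolding norm_vec_def[of "A *v x"] by (intro L2_set_mono) auto
  also have "\<dots> = norm A * norm x"
    unfolding norm_vec_def[of A] by (simp add: L2_set_left_distrib)
  finally show ?thesis .
qed

lemma ell2_norm_sq: "(ell2_norm G u)\<^sup>2 = (\<Sum>\<^sub>\<infinity>n\<in>G. (norm (u n))\<^sup>2)"
  unfolding ell2_norm_def by (simp add: infsum_nonneg)

lemma ell2_dominated:
  assumes v: "v \<in> ell2 G" and K: "0 \<le> K"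
    and u: "\<And>n. n \<notin> G \<Longrightarrow> u n = 0" "\<And>n. n \<in> G \<Longrightarrow> norm (u n) \<le> K * norm (v n)"
  shows "u \<in> ell2 G" and "ell2_norm G u \<le> K * ell2_norm G v"
proof -
  have s: "(\<lambda>n. K\<^sup>2 * (norm (v n))\<^sup>2) summable_on G"
    using v by (auto simp: ell2_def intro: summable_on_cmult_right)
  have le: "(norm (u n))\<^sup>2 \<le> K\<^sup>2 * (norm (v n))\<^sup>2" if "n \<in> G" for n
    using power_mono[OF u(2)[OF that], of 2] by (simp add: power_mult_distrib)
  show uG: "u \<in> ell2 G"
    using summable_on_comparison_test[OF s le] u by (simp add: ell2_def)
  have "(ell2_norm G u)\<^sup>2 \<le> (\<Sum>\<^sub>\<infinity>n\<in>G. K\<^sup>2 * (norm (v n))\<^sup>2)"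
    unfolding ell2_norm_sq using uG s le by (intro infsum_mono) (auto simp: ell2_def)
  also have "\<dots> = (K * ell2_norm G v)\<^sup>2"
    by (simp add: infsum_cmult_right' ell2_norm_sq power_mult_distrib)
  finally show "ell2_norm G u \<le> K * ell2_norm G v"
    by (rule power2_le_imp_le) (use K ell2_norm_nonneg in auto)
qed

lemma ell_infty_bound:
  assumes "W \<in> ell_infty G"
  obtains K where "0 \<le> K" "\<And>n. norm (W n) \<le> K"
proof -
  obtain K where K: "\<And>n. n \<in> G \<Longrightarrow> norm (W n) \<le> K"
    using assms by (auto simp: ell_infty_def bounded_iff)
  have "norm (W n) \<le> max K 0" for n
    using K[of n] assms by (cases "n \<in> G") (auto simp: ell_infty_def)
  then show ?thesis using that[of "max K 0"] by simp
qed

lemma norm_mult_op_le: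
  assumes "norm (W n) \<le> c"
  shows "norm (mult_op W u n) \<le> c * norm (u n)"
  unfolding mult_op_def
  using norm_matrix_vector_mult_le[of "W n" "u n"] mult_right_mono[OF assms, of "norm (u n)"]
  by simp

lemma mult_op_ell2:
  assumes W: "W \<in> ell_infty G" and u: "u \<in> ell2 G"
  shows "mult_op W u \<in> ell2 G"
proof -
  obtain K where K: "0 \<le> K" "\<And>n. norm (W n) \<le> K" using ell_infty_bound[OF W] by blast
  show ?thesis
    by (rule ell2_dominated(1)[OF u K(1)])
      (use u K(2) in \<open>simp_all add: norm_mult_op_le, simp add: mult_op_def ell2_def\<close>)
qed

lemma bounded_op_mult_op:
  assumes W: "W \<in> ell_infty G"
  shows "bounded_op G (mult_op W)"
proof -
  obtain K where K: "0 \<le> K" "\<And>n. norm (W n) \<le> K" using ell_infty_bound[OF W] by blast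
  have "ell2_norm G (mult_op W u) \<le> K * ell2_norm G u" if u: "u \<in> ell2 G" for u
    by (rule ell2_dominated(2)[OF u K(1)])
      (use u K(2) in \<open>simp_all add: norm_mult_op_le, simp add: mult_op_def ell2_def\<close>)
  then show ?thesis
    unfolding bounded_op_def using mult_op_ell2[OF W]
    by (auto simp: mult_op_def matrix_vector_right_distrib vec.scale)
qed

lemma self_adjoint_mult_op:
  assumes W: "W \<in> ell_infty G" and adj: "W = adjoint_seq W"
  shows "self_adjoint_op G (mult_op W)"
proof -
  have c: "cnj (W n $ i $ j) = W n $ j $ i" for n i j
    \<comment> \<open>Both sides of \<open>adj\<close> mention \<open>W\<close>, so only the
      occurrence on the right of the goal is rewritten.\<close>
    by (subst (2) adj) (simp add: adjoint_seq_def)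
  have "(\<Sum>i\<in>UNIV. (W n *v x) $ i * cnj (y $ i)) = (\<Sum>i\<in>UNIV. x $ i * cnj ((W n *v y) $ i))"
    for n x y
    by (simp add: matrix_vector_mult_def sum_2 c algebra_simps)
  then show ?thesis
    unfolding self_adjoint_op_def is_adjoint_op_def ell2_inner_def
    using bounded_op_mult_op[OF W] mult_op_ell2[OF W] by (simp add: mult_op_def)
qed

text \<open>Here compactness refers to pointwise convergence (the topology of the function type), not to
  the metric of \<open>ell2 G\<close>.\<close>
lemma compact_ell2_unit_ball: "compact {u \<in> ell2 G. ell2_norm G u \<le> 1}"
proof -
  \<comment> \<open>The infinite sum is not continuous under pointwise convergence, but each finite
    partial sum is, so the norm bound becomes an intersection of closed conditions.\<close>
  define B where "B = (\<Inter>F\<in>{F. finite F \<and> F \<subseteq> G}. {u :: int \<Rightarrow> complex^2. (\<Sum>n\<in>F. (norm (u n))\<^sup>2) \<le> 1})"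
  have coord: "continuous_on UNIV (\<lambda>u :: int \<Rightarrow> complex^2. u n)" for n
    by simp
  have "closed B"
    unfolding B_def by (intro closed_INT ballI closed_Collect_le continuous_intros coord)
  \<comment> \<open>Tychonoff. The factor \<open>{0}\<close> at indices outside \<open>G\<close>
    encodes that elements of \<open>ell2 G\<close> vanish there.\<close>
  moreover have "compact (\<Pi>\<^sub>E n\<in>UNIV. if n \<in> G then cball 0 1 else {0 :: complex^2})"
    using compactin_PiE[of "\<lambda>_. euclidean" UNIV "\<lambda>n::int. if n \<in> G then cball 0 1 else {0 :: complex^2}"]
    by (simp add: euclidean_product_topology)
  ultimately have "compact (B \<inter> (\<Pi>\<^sub>E n\<in>UNIV. if n \<in> G then cball 0 1 else {0}))"
    by (rule closed_Int_compact)
  also have "B \<inter> (\<Pi>\<^sub>E n\<in>UNIV. if n \<in> G then cball 0 1 else {0}) = {u \<in> ell2 G. ell2_norm G u \<le> 1}"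
    (is "?L = ?R")
  proof (intro equalityI subsetI)
    fix u assume u: "u \<in> ?L"
    have b: "(\<Sum>n\<in>F. (norm (u n))\<^sup>2) \<le> 1" if "finite F" "F \<subseteq> G" for F
      using u that by (auto simp: B_def)
    have z: "u n = 0" if "n \<notin> G" for n
    proof -
      have "u n \<in> (if n \<in> G then cball 0 1 else {0})" using u by (auto simp: PiE_iff)
      then show ?thesis using that by simp
    qed
    have s: "(\<lambda>n. (norm (u n))\<^sup>2) summable_on G"
      by (rule nonneg_bdd_above_summable_on) (use b in \<open>auto simp: bdd_above_def\<close>)
    have "(ell2_norm G u)\<^sup>2 \<le> 1" unfolding ell2_norm_sq by (rule infsum_le_finite_sums[OF s b])
    then show "u \<in> ?R" using z s ell2_norm_nonneg[of G u] by (simp add: ell2_def abs_square_le_1)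
  next
    fix u assume u: "u \<in> ?R"
    have b: "(\<Sum>n\<in>F. (norm (u n))\<^sup>2) \<le> 1" if "finite F" "F \<subseteq> G" for F
    proof -
      have "u \<in> ell2 G" "ell2_norm G u \<le> 1" using u by auto
      then have "sqrt (\<Sum>n\<in>F. (norm (u n))\<^sup>2) \<le> 1"
        using L2_set_le_ell2_norm[of u G F] that unfolding L2_set_def by linarith
      then show ?thesis by simp
    qed
    have "norm (u n) \<le> 1" if "n \<in> G" for n
      using b[of "{n}"] that by (simp add: power_le_one_iff)
    then show "u \<in> ?L" using b u by (auto simp: B_def PiE_iff ell2_def)
  qed
  finally show ?thesis .
qed

text \<open>On the unit ball, multiplication by a vanishing \<open>W\<close> is continuous from
  pointwise convergence to the norm: all but finitely many coordinates are damped uniformly, and the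
  remaining ones are controlled pointwise. The image of the pointwise compact ball is therefore norm
  compact, hence closed, and equals its closure.\<close>

lemma compact_op_mult_op:
  assumes W: "W \<in> ell_infty G"
    and lim: "((\<lambda>n. norm (W n)) \<longlongrightarrow> 0) (inf (filtercomap abs at_top) (principal G))"
  shows "compact_op G (mult_op W)"
proof -
  interpret Metric_space "ell2 G" "ell2_dist G" by (rule Metric_space_ell2)
  let ?B = "{u \<in> ell2 G. ell2_norm G u \<le> 1}"
  obtain K where K: "0 \<le> K" "\<And>n. norm (W n) \<le> K" using ell_infty_bound[OF W] by blast
  have "continuous_map (top_of_set ?B) mtopology (mult_op W)"
    unfolding continuous_map_to_metric
  proof (intro ballI allI impI)
    fix u and \<epsilon> :: real assume u: "u \<in> topspace (top_of_set ?B)" and \<epsilon>: "0 < \<epsilon>"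
    \<comment> \<open>Two points of the ball differ by norm at most 2, so the coordinates outside
      \<open>F\<close> contribute at most (eps/4)^2 * 4 = eps^2/4 to the squared distance. The
      neighbourhood \<open>U\<close> below allows the same amount on \<open>F\<close>, and the total
      eps^2/2 is below eps^2.\<close>
    define F where "F = {n \<in> G. \<epsilon> / 4 \<le> norm (W n)}"
    have "eventually (\<lambda>n. norm (W n) < \<epsilon> / 4) (inf (filtercomap abs at_top) (principal G))"
      by (rule order_tendstoD(2)[OF lim]) (use \<epsilon> in simp)
    then obtain N where N: "\<And>n. N \<le> \<bar>n\<bar> \<Longrightarrow> n \<in> G \<Longrightarrow> norm (W n) < \<epsilon> / 4"
      by (auto simp: eventually_inf_principal eventually_filtercomap_at_top_linorder)
    have "F \<subseteq> {-N..N}" unfolding F_def using N by force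
    then have F: "finite F" by (rule finite_subset) simp
    define U where "U = {v :: int \<Rightarrow> complex^2. K\<^sup>2 * (\<Sum>n\<in>F. (norm (u n - v n))\<^sup>2) < \<epsilon>\<^sup>2 / 4}"
    have "continuous_on UNIV (\<lambda>v :: int \<Rightarrow> complex^2. v n)" for n by simp
    then have "open U" unfolding U_def by (intro open_Collect_less continuous_intros)
    moreover have "mult_op W v \<in> mball (mult_op W u) \<epsilon>" if v: "v \<in> ?B \<inter> U" for v
    proof -
      let ?w = "\<lambda>n. u n - v n"
      have uv: "u \<in> ell2 G" "v \<in> ell2 G" "ell2_norm G u \<le> 1" "ell2_norm G v \<le> 1"
        using u v by auto
      have w: "?w \<in> ell2 G" by (rule ell2_diff) (use uv in auto)
      have "ell2_norm G ?w \<le> ell2_norm G u + ell2_norm G (\<lambda>n. - v n)"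
        using ell2_norm_triangle[OF uv(1) ell2_minus[OF uv(2)]] by simp
      also have "ell2_norm G (\<lambda>n. - v n) = ell2_norm G v" by (simp add: ell2_norm_def)
      finally have "ell2_norm G ?w \<le> 2" using uv by simp
      then have w2: "(ell2_norm G ?w)\<^sup>2 \<le> 4"
        using power_mono[of "ell2_norm G ?w" 2 2] ell2_norm_nonneg by simp
      have d: "(\<lambda>n. mult_op W u n - mult_op W v n) = mult_op W ?w"
        by (simp add: mult_op_def matrix_vector_mult_diff_distrib)
      have "(ell2_norm G (mult_op W ?w))\<^sup>2 \<le> \<epsilon>\<^sup>2 / 2"
        unfolding ell2_norm_sq
      proof (rule infsum_le_finite_sums)
        show "(\<lambda>n. (norm (mult_op W ?w n))\<^sup>2) summable_on G"
          using mult_op_ell2[OF W w] by (simp add: ell2_def)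
        fix E assume E: "finite E" "E \<subseteq> G"
        have sq: "(norm (mult_op W ?w n))\<^sup>2 \<le> c\<^sup>2 * (norm (?w n))\<^sup>2" if "norm (W n) \<le> c" for n c
          using power_mono[OF norm_mult_op_le[of W n c ?w], of 2] that by (simp add: power_mult_distrib)
        have "(\<Sum>n\<in>E \<inter> F. (norm (mult_op W ?w n))\<^sup>2) \<le> (\<Sum>n\<in>E \<inter> F. K\<^sup>2 * (norm (?w n))\<^sup>2)"
          by (intro sum_mono sq K)
        also have "\<dots> \<le> (\<Sum>n\<in>F. K\<^sup>2 * (norm (?w n))\<^sup>2)"
          by (rule sum_mono2[OF F]) auto
        also have "\<dots> \<le> \<epsilon>\<^sup>2 / 4" using v by (simp add: U_def sum_distrib_left)
        finally have 1: "(\<Sum>n\<in>E \<inter> F. (norm (mult_op W ?w n))\<^sup>2) \<le> \<epsilon>\<^sup>2 / 4" .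
        have "(\<Sum>n\<in>E - F. (norm (mult_op W ?w n))\<^sup>2) \<le> (\<Sum>n\<in>E - F. (\<epsilon> / 4)\<^sup>2 * (norm (?w n))\<^sup>2)"
          by (intro sum_mono sq) (use E in \<open>auto simp: F_def\<close>)
        also have "\<dots> \<le> (\<epsilon> / 4)\<^sup>2 * (ell2_norm G ?w)\<^sup>2"
          unfolding ell2_norm_sq sum_distrib_left[symmetric]
          by (intro mult_left_mono finite_sum_le_infsum) (use E w in \<open>auto simp: ell2_def\<close>)
        also have "\<dots> \<le> (\<epsilon> / 4)\<^sup>2 * 4" by (intro mult_left_mono w2) simp
        finally have 2: "(\<Sum>n\<in>E - F. (norm (mult_op W ?w n))\<^sup>2) \<le> \<epsilon>\<^sup>2 / 4"
          by (simp add: power_divide)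
        show "(\<Sum>n\<in>E. (norm (mult_op W ?w n))\<^sup>2) \<le> \<epsilon>\<^sup>2 / 2"
          using 1 2 sum.Int_Diff[OF E(1), of "\<lambda>n. (norm (mult_op W ?w n))\<^sup>2" F] by simp
      qed
      also have "\<dots> < \<epsilon>\<^sup>2" using \<epsilon> by simp
      finally have "ell2_norm G (mult_op W ?w) < \<epsilon>"
        by (rule power2_less_imp_less) (use \<epsilon> in simp)
      then show ?thesis
        using mult_op_ell2[OF W] uv by (simp add: ell2_dist_def d)
    qed
    ultimately show "\<exists>U. openin (top_of_set ?B) U \<and> u \<in> U \<and> (\<forall>v\<in>U. mult_op W v \<in> mball (mult_op W u) \<epsilon>)"
      using u \<epsilon> by (intro exI[of _ "?B \<inter> U"]) (auto simp: U_def openin_open_Int)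
  qed
  moreover have "compactin (top_of_set ?B) ?B"
    using compact_ell2_unit_ball by (simp add: compactin_subtopology)
  ultimately have "compactin mtopology (mult_op W ` ?B)" by (rule image_compactin[rotated])
  then have "compactin mtopology (mtopology closure_of (mult_op W ` ?B))"
    using compactin_imp_closedin[OF Hausdorff_space_mtopology] by (simp add: closure_of_closedin)
  then show ?thesis unfolding compact_op_def using bounded_op_mult_op[OF W] by blast
qed

section \<open>Difference estimates for functions of the logarithm\<close>

text \<open>By the mean value theorem the first difference is \<open>g' z\<close> with z > x - 1,
  and x <= 2z when x >= 2. Applied to the increment \<open>g t - g (t - 1)\<close> and then to
  \<open>g'\<close>, it turns the second difference into \<open>g'' y\<close> with y > x - 2, and x
  <= 3y when x >= 3, whence the factor 9. The thresholds also keep all points used at 1 or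
  above.\<close>

lemma second_order_slowly_varying:
  fixes g g' g'' :: "real \<Rightarrow> real"
  assumes g: "\<And>x. 1 \<le> x \<Longrightarrow> (g has_real_derivative g' x) (at x)"
    and g': "\<And>x. 1 \<le> x \<Longrightarrow> (g' has_real_derivative g'' x) (at x)"
    and C: "\<And>x. 1 \<le> x \<Longrightarrow> \<bar>x * g' x\<bar> \<le> C" "\<And>x. 1 \<le> x \<Longrightarrow> \<bar>x\<^sup>2 * g'' x\<bar> \<le> C"
  shows "2 \<le> x \<Longrightarrow> \<bar>x * (g x - g (x - 1))\<bar> \<le> 2 * C"
    and "3 \<le> x \<Longrightarrow> \<bar>x\<^sup>2 * (g x - 2 * g (x - 1) + g (x - 2))\<bar> \<le> 9 * C"
proof -
  assume x: "2 \<le> x"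
  obtain z where z: "x - 1 < z" "z < x" "g x - g (x - 1) = (x - (x - 1)) * g' z"
    using MVT2[of "x - 1" x g g'] g x by fastforce
  have "\<bar>x * g' z\<bar> \<le> \<bar>2 * z * g' z\<bar>"
    unfolding abs_mult by (rule mult_right_mono) (use z x in auto)
  also have "\<dots> \<le> 2 * C" using C(1)[of z] z x by (simp add: abs_mult)
  finally show "\<bar>x * (g x - g (x - 1))\<bar> \<le> 2 * C" using z by simp
next
  assume x: "3 \<le> x"
  have "\<exists>z. x - 1 < z \<and> z < x \<and> (g x - g (x - 1)) - (g (x - 1) - g (x - 1 - 1))
      = (x - (x - 1)) * (g' z - g' (z - 1))"
  proof (rule MVT2[of "x - 1" x "\<lambda>t. g t - g (t - 1)" "\<lambda>t. g' t - g' (t - 1)"])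
    fix t assume t: "x - 1 \<le> t" "t \<le> x"
    have "((\<lambda>t. g (t - 1)) has_real_derivative g' (t - 1) * 1) (at t)"
      by (rule DERIV_chain2[OF g]) (use t x in \<open>auto intro!: derivative_eq_intros\<close>)
    then show "((\<lambda>t. g t - g (t - 1)) has_real_derivative g' t - g' (t - 1)) (at t)"
      by (intro DERIV_diff g) (use t x in auto)
  qed simp
  then obtain z where z: "x - 1 < z" "z < x"
    "g x - g (x - 1) - (g (x - 1) - g (x - 2)) = g' z - g' (z - 1)" by auto
  obtain y where y: "z - 1 < y" "y < z" "g' z - g' (z - 1) = (z - (z - 1)) * g'' y"
    using MVT2[of "z - 1" z g' g''] g' x z by fastforce
  have "x\<^sup>2 \<le> (3 * y)\<^sup>2" by (rule power_mono) (use z x y in auto)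
  then have "\<bar>x\<^sup>2 * g'' y\<bar> \<le> \<bar>(3 * y)\<^sup>2 * g'' y\<bar>"
    unfolding abs_mult by (intro mult_right_mono) auto
  also have "\<dots> \<le> 9 * C" using C(2)[of y] z x y by (simp add: abs_mult power_mult_distrib)
  also have "g'' y = g x - 2 * g (x - 1) + g (x - 2)" using z y by simp
  finally show "\<bar>x\<^sup>2 * (g x - 2 * g (x - 1) + g (x - 2))\<bar> \<le> 9 * C" .
qed

definition log_wave :: "real \<Rightarrow> real" where
  "log_wave x = cos (pi * log 2 x) / (1 + log 2 x)"

lemma abs_log_wave_le:
  assumes "1 \<le> x"
  shows "\<bar>log_wave x\<bar> \<le> 1 / (1 + log 2 x)"
proof -
  have "0 \<le> log 2 x" using assms by simp
  then show ?thesis by (simp add: log_wave_def divide_right_mono)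
qed

text \<open>In the variable t = log_2 x the function is cos(pi t)/(1 + t), whose first two
  derivatives are bounded for t >= 0. Each derivative in x gains a factor 1/x by the chain rule,
  which is the decay required by \<open>second_order_slowly_varying\<close>.\<close>

lemma log_wave_differences:
  obtains C where "\<And>x. 2 \<le> x \<Longrightarrow> \<bar>x * (log_wave x - log_wave (x - 1))\<bar> \<le> C"
    and "\<And>x. 3 \<le> x \<Longrightarrow> \<bar>x\<^sup>2 * (log_wave x - 2 * log_wave (x - 1) + log_wave (x - 2))\<bar> \<le> C"
proof -
  \<comment> \<open>\<open>s1\<close> and \<open>s2\<close> are the first and second derivatives of
    cos(pi t)/(1 + t); \<open>g'\<close> and \<open>g''\<close> are those of
    \<open>log_wave\<close>.\<close>
  define s1 where "s1 t = - pi * sin (pi * t) / (1 + t) - cos (pi * t) / (1 + t)\<^sup>2" for t :: real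
  define s2 where "s2 t = - pi\<^sup>2 * cos (pi * t) / (1 + t) + 2 * pi * sin (pi * t) / (1 + t)\<^sup>2
    + 2 * cos (pi * t) / (1 + t) ^ 3" for t :: real
  define g' where "g' x = s1 (log 2 x) / (ln 2 * x)" for x :: real
  define g'' where "g'' x = (s2 (log 2 x) / (ln 2)\<^sup>2 - s1 (log 2 x) / ln 2) / x\<^sup>2" for x :: real
  have s: "((\<lambda>t. cos (pi * t) / (1 + t)) has_real_derivative s1 t) (at t)" if "0 \<le> t" for t
    unfolding s1_def using that
    by (auto intro!: derivative_eq_intros simp: divide_simps power2_eq_square)
  have s1: "(s1 has_real_derivative s2 t) (at t)" if "0 \<le> t" for t
  proof -
    have nz: "1 + t \<noteq> 0" using that by simp
    have "((\<lambda>t. - pi * sin (pi * t) / (1 + t)) has_real_derivative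
        - pi\<^sup>2 * cos (pi * t) / (1 + t) + pi * sin (pi * t) / (1 + t)\<^sup>2) (at t)"
      by (rule derivative_eq_intros refl nz | simp)+ (use nz in \<open>simp add: diff_divide_distrib power2_eq_square mult.commute\<close>)
    moreover have "((\<lambda>t. cos (pi * t) / (1 + t)\<^sup>2) has_real_derivative
        - pi * sin (pi * t) / (1 + t)\<^sup>2 - 2 * cos (pi * t) / (1 + t) ^ 3) (at t)"
    proof -
      have "((\<lambda>t. cos (pi * t)) has_real_derivative - pi * sin (pi * t)) (at t)"
        by (auto intro!: derivative_eq_intros)
      moreover have "((\<lambda>t. (1 + t)\<^sup>2) has_real_derivative 2 * (1 + t)) (at t)"
        by (auto intro!: derivative_eq_intros)
      ultimately have "((\<lambda>t. cos (pi * t) / (1 + t)\<^sup>2) has_real_derivative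
          (- pi * sin (pi * t) * (1 + t)\<^sup>2 - cos (pi * t) * (2 * (1 + t))) / ((1 + t)\<^sup>2 * (1 + t)\<^sup>2)) (at t)"
        by (rule DERIV_divide) (use nz in simp)
      \<comment> \<open>With d = 1 + t this cancels the powers left by the quotient rule.\<close>
      moreover have "(a * d\<^sup>2 - b * (2 * d)) / (d\<^sup>2 * d\<^sup>2) = a / d\<^sup>2 - 2 * b / d ^ 3"
        if "d \<noteq> 0" for a b d :: real
        using that by (simp add: diff_divide_distrib power2_eq_square power3_eq_cube mult_ac)
      ultimately show ?thesis using nz by (simp only: not_False_eq_True)
    qed
    ultimately show ?thesis
      unfolding s1_def[abs_def] s2_def by (rule DERIV_cong[OF DERIV_diff]) simp
  qed
  have log: "(log 2 has_real_derivative 1 / (ln 2 * x)) (at x)" if "1 \<le> x" for x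
    using that by (auto intro!: derivative_eq_intros)
  \<comment> \<open>The denominators are at least 1 for t >= 0, so it suffices to bound the
    numerators.\<close>
  have frac: "\<bar>a / (1 + t) ^ k\<bar> \<le> c" if "0 \<le> t" "\<bar>a\<bar> \<le> c" for a c t :: real and k :: nat
  proof -
    have "1 \<le> (1 + t) ^ k" using that by (simp add: one_le_power)
    then have "\<bar>a\<bar> * 1 \<le> c * (1 + t) ^ k" using that(2) by (intro mult_mono) auto
    then show ?thesis using that by (simp add: divide_simps)
  qed
  have bound: "\<bar>c * sin y\<bar> \<le> c" "\<bar>c * cos y\<bar> \<le> c" if "0 \<le> c" for c y :: real
    using that by (simp_all add: abs_mult mult_left_le)
  have b1: "\<bar>s1 t\<bar> \<le> pi + 1" if "0 \<le> t" for t
  proof -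
    have "\<bar>pi * sin (pi * t) / (1 + t)\<bar> \<le> pi"
      using frac[OF that bound(1), of pi _ 1] by simp
    moreover have "\<bar>cos (pi * t) / (1 + t)\<^sup>2\<bar> \<le> 1" by (rule frac[OF that]) simp
    ultimately show ?thesis unfolding s1_def mult_minus_left minus_divide_left[symmetric] by linarith
  qed
  have b2: "\<bar>s2 t\<bar> \<le> pi\<^sup>2 + 2 * pi + 2" if "0 \<le> t" for t
  proof -
    have "\<bar>pi\<^sup>2 * cos (pi * t) / (1 + t)\<bar> \<le> pi\<^sup>2"
      using frac[OF that bound(2), of "pi\<^sup>2" _ 1] by simp
    moreover have "\<bar>2 * pi * sin (pi * t) / (1 + t)\<^sup>2\<bar> \<le> 2 * pi"
      by (rule frac[OF that bound(1)]) simp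
    moreover have "\<bar>2 * cos (pi * t) / (1 + t) ^ 3\<bar> \<le> 2"
      by (rule frac[OF that bound(2)]) simp
    ultimately show ?thesis unfolding s2_def mult_minus_left minus_divide_left[symmetric] by linarith
  qed
  \<comment> \<open>The first summand bounds |x g'|; both together bound |x^2 g''|, which involves
    \<open>s1\<close> as well as \<open>s2\<close>.\<close>
  define C where "C = (pi + 1) / ln 2 + (pi\<^sup>2 + 2 * pi + 2) / (ln 2)\<^sup>2"
  have C0: "0 \<le> (pi\<^sup>2 + 2 * pi + 2) / (ln 2)\<^sup>2" "0 \<le> (pi + 1) / ln 2"
    by (auto intro!: divide_nonneg_nonneg add_nonneg_nonneg)
  have d1: "(log_wave has_real_derivative g' x) (at x)" if "1 \<le> x" for x
    using DERIV_chain2[OF s log, of x] that unfolding log_wave_def[abs_def] g'_def by simp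
  have d2: "(g' has_real_derivative g'' x) (at x)" if "1 \<le> x" for x
  proof -
    have "((\<lambda>x. s1 (log 2 x)) has_real_derivative s2 (log 2 x) * (1 / (ln 2 * x))) (at x)"
      by (rule DERIV_chain2[OF s1 log]) (use that in auto)
    then have "((\<lambda>x. s1 (log 2 x) / (ln 2 * x)) has_real_derivative
        (s2 (log 2 x) * (1 / (ln 2 * x)) * (ln 2 * x) - s1 (log 2 x) * (ln 2 * 1)) / ((ln 2 * x) * (ln 2 * x))) (at x)"
      by (rule DERIV_divide) (use that in \<open>auto intro!: derivative_eq_intros\<close>)
    moreover have "(s2 (log 2 x) * (1 / (ln 2 * x)) * (ln 2 * x) - s1 (log 2 x) * (ln 2 * 1)) / ((ln 2 * x) * (ln 2 * x)) = g'' x"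
      unfolding g''_def using that by (simp add: field_simps power2_eq_square)
    ultimately show ?thesis unfolding g'_def[abs_def] by simp
  qed
  have e1: "\<bar>x * g' x\<bar> \<le> C" if "1 \<le> x" for x
  proof -
    have "\<bar>x * g' x\<bar> = \<bar>s1 (log 2 x)\<bar> / ln 2" unfolding g'_def using that by (simp add: abs_mult)
    also have "\<dots> \<le> (pi + 1) / ln 2" by (intro divide_right_mono b1) (use that in auto)
    finally show ?thesis using C0 unfolding C_def by linarith
  qed
  have e2: "\<bar>x\<^sup>2 * g'' x\<bar> \<le> C" if "1 \<le> x" for x
  proof -
    have "\<bar>x\<^sup>2 * g'' x\<bar> = \<bar>s2 (log 2 x) / (ln 2)\<^sup>2 - s1 (log 2 x) / ln 2\<bar>"
      unfolding g''_def using that by simp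
    also have "\<dots> \<le> \<bar>s2 (log 2 x)\<bar> / (ln 2)\<^sup>2 + \<bar>s1 (log 2 x)\<bar> / ln 2"
      using abs_triangle_ineq4[of "s2 (log 2 x) / (ln 2)\<^sup>2" "s1 (log 2 x) / ln 2"] by simp
    also have "\<dots> \<le> C" unfolding C_def add.commute[of "(pi + 1) / ln 2"]
      by (intro add_mono divide_right_mono b1 b2) (use that in auto)
    finally show ?thesis .
  qed
  have "0 \<le> C" using C0 unfolding C_def by linarith
  note d = second_order_slowly_varying[OF d1 d2 e1 e2]
  show ?thesis
  proof (rule that)
    show "\<bar>x * (log_wave x - log_wave (x - 1))\<bar> \<le> 9 * C" if "2 \<le> x" for x
      using d(1)[OF _ _ _ _ that] \<open>0 \<le> C\<close> by simp
    show "\<bar>x\<^sup>2 * (log_wave x - 2 * log_wave (x - 1) + log_wave (x - 2))\<bar> \<le> 9 * C" if "3 \<le> x" for x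
      using d(2)[OF _ _ _ _ that] by simp
  qed
qed

section \<open>Unbounded variation along the multiples of p\<close>

text \<open>A zero of the cosine would make 2 log_2 p an odd integer m, so that p^2 = 2^m. The
  exponent of 2 in p^2 is even, a contradiction.\<close>

lemma cos_pi_log2_neq_0:
  assumes "1 \<le> (p :: nat)"
  shows "cos (pi * log 2 p) \<noteq> 0"
proof
  assume "cos (pi * log 2 p) = 0"
  then obtain i where i: "odd i" "pi * log 2 p = of_int i * (pi / 2)"
    unfolding cos_zero_iff_int by blast
  then have l: "2 * log 2 p = of_int i" by simp
  moreover have "0 \<le> log 2 (real p)" using assms by simp
  ultimately have "0 \<le> i" by linarith
  then obtain m where m: "i = int m" using nonneg_int_cases by blast
  have "real (p ^ 2) = (2 powr log 2 p) * (2 powr log 2 p)"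
    using assms by (simp add: power2_eq_square)
  also have "\<dots> = 2 powr (2 * log 2 p)" by (simp only: mult_2 powr_add)
  also have "\<dots> = real (2 ^ m)" using l m by (simp add: powr_realpow)
  finally have "p ^ 2 = 2 ^ m" by (metis of_nat_eq_iff)
  then have "multiplicity 2 (p ^ 2) = multiplicity 2 ((2::nat) ^ m)" by simp
  then have "2 * multiplicity 2 p = m"
    using assms by (simp add: prime_elem_multiplicity_power_distrib)
  then show False using i m by auto
qed

text \<open>The increment from \<open>r k\<close> to \<open>r (Suc k)\<close> telescopes over that
  block of indices. The blocks are adjacent, so the triangle inequality bounds the variation along
  \<open>r\<close> by the total variation.\<close>

lemma summable_variation_subseq:
  fixes a :: "nat \<Rightarrow> real"
  assumes a: "summable (\<lambda>j. \<bar>a (Suc j) - a j\<bar>)" and r: "mono r"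
  shows "summable (\<lambda>k. \<bar>a (r (Suc k)) - a (r k)\<bar>)"
proof (rule bounded_imp_summable)
  have *: "(\<Sum>k<K. \<bar>a (r (Suc k)) - a (r k)\<bar>) \<le> (\<Sum>j=r 0..<r K. \<bar>a (Suc j) - a j\<bar>)" for K
  proof (induction K)
    case (Suc K)
    have m: "r 0 \<le> r K" "r K \<le> r (Suc K)" using r by (auto simp: mono_def)
    have "\<bar>a (r (Suc K)) - a (r K)\<bar> = \<bar>\<Sum>j=r K..<r (Suc K). a (Suc j) - a j\<bar>"
      using m by (simp add: sum_Suc_diff')
    also have "\<dots> \<le> (\<Sum>j=r K..<r (Suc K). \<bar>a (Suc j) - a j\<bar>)" by (rule sum_abs)
    finally show ?case using Suc sum.atLeastLessThan_concat[OF m, of "\<lambda>j. \<bar>a (Suc j) - a j\<bar>"] by simp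
  qed simp
  fix K
  have "(\<Sum>k\<le>K. \<bar>a (r (Suc k)) - a (r k)\<bar>) \<le> (\<Sum>j=r 0..<r (Suc K). \<bar>a (Suc j) - a j\<bar>)"
    using *[of "Suc K"] by (simp only: lessThan_Suc_atMost)
  also have "\<dots> \<le> (\<Sum>j. \<bar>a (Suc j) - a j\<bar>)" by (rule sum_le_suminf[OF a]) auto
  finally show "(\<Sum>k\<le>K. \<bar>a (r (Suc k)) - a (r k)\<bar>) \<le> (\<Sum>j. \<bar>a (Suc j) - a j\<bar>)" .
qed simp

lemma log_wave_dyadic:
  assumes "1 \<le> (p :: nat)"
  shows "log_wave (real (p * 2 ^ k)) = (-1) ^ k * cos (pi * log 2 p) / (1 + log 2 p + k)"
proof -
  have "log 2 (real (p * 2 ^ k)) = log 2 p + k"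
    using assms by (simp add: log_mult log_nat_power)
  moreover have "cos (pi * (log 2 p + k)) = (-1) ^ k * cos (pi * log 2 p)"
    by (simp add: distrib_left cos_add)
  ultimately show ?thesis by (simp add: log_wave_def add.assoc)
qed

text \<open>Passing to the indices \<open>p * 2 ^ k\<close> can only decrease the variation.
  Consecutive values there have opposite signs, so each jump is the sum of their absolute values and
  is at least a nonzero multiple of 1/(1 + log_2 p + k).\<close>

lemma log_wave_unbounded_variation:
  assumes p: "1 \<le> (p :: nat)"
  shows "\<not> summable (\<lambda>j. \<bar>log_wave (real (p * Suc (Suc j))) - log_wave (real (p * Suc j))\<bar>)"
proof
  let ?c = "\<bar>cos (pi * log 2 p)\<bar>" and ?l = "log 2 p"
  assume "summable (\<lambda>j. \<bar>log_wave (real (p * Suc (Suc j))) - log_wave (real (p * Suc j))\<bar>)"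
  \<comment> \<open>One extra term at j = 0 makes the index j itself the multiplier, so that j = 2^k
    can be substituted.\<close>
  then have "summable (\<lambda>j. \<bar>log_wave (real (p * Suc j)) - log_wave (real (p * j))\<bar>)"
    using summable_Suc_iff[of "\<lambda>j. \<bar>log_wave (real (p * Suc j)) - log_wave (real (p * j))\<bar>"] by simp
  then have "summable (\<lambda>k. \<bar>log_wave (real (p * 2 ^ Suc k)) - log_wave (real (p * 2 ^ k))\<bar>)"
    by (rule summable_variation_subseq[of "\<lambda>j. log_wave (real (p * j))"]) (simp add: mono_def)
  \<comment> \<open>Replacing 1 + log_2 p by a larger integer turns the lower bound into a shifted
    harmonic series.\<close>
  moreover obtain N :: nat where N: "1 + ?l \<le> N" using real_arch_simple by blast
  have l: "0 \<le> ?l" using p by simp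
  have lower: "?c * inverse (real (k + N)) \<le> \<bar>log_wave (real (p * 2 ^ Suc k)) - log_wave (real (p * 2 ^ k))\<bar>" for k
  proof -
    have "log_wave (real (p * 2 ^ Suc k)) - log_wave (real (p * 2 ^ k))
      = - ((-1) ^ k * cos (pi * ?l)) * (1 / (1 + ?l + Suc k) + 1 / (1 + ?l + k))"
      unfolding log_wave_dyadic[OF p] by (simp add: algebra_simps add_divide_distrib)
    then have *: "\<bar>log_wave (real (p * 2 ^ Suc k)) - log_wave (real (p * 2 ^ k))\<bar>
      = ?c * (1 / (1 + ?l + Suc k) + 1 / (1 + ?l + k))"
      using l by (simp add: abs_mult power_abs)
    moreover have "inverse (real (k + N)) \<le> 1 / (1 + ?l + k)"
      using N l by (simp add: inverse_eq_divide frac_le)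
    moreover have "0 \<le> 1 / (1 + ?l + Suc k)" using l by simp
    ultimately have "?c * inverse (real (k + N)) \<le> ?c * (1 / (1 + ?l + Suc k) + 1 / (1 + ?l + k))"
      by (intro mult_left_mono) linarith+
    then show ?thesis by (simp only: *)
  qed
  ultimately have "summable (\<lambda>k. ?c * inverse (real (k + N)))"
    by (elim summable_comparison_test'[where N = 0])
      (simp only: real_norm_def abs_mult abs_abs abs_inverse abs_of_nat)
  then have "summable (\<lambda>k. inverse (real (k + N)))"
    using cos_pi_log2_neq_0[OF p] by (simp add: summable_cmult_iff)
  then show False using not_summable_harmonic[where 'a = real]
    by (subst (asm) summable_iff_shift) blast
qed

section \<open>The sequence on the integers\<close>

text \<open>The cutoff lets the same sequence serve both index sets and avoids the pole of
  \<open>log_wave\<close> at 1/2.\<close>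

definition log_wave_seq :: "int \<Rightarrow> real" where
  "log_wave_seq n = (if 1 \<le> n then log_wave (real_of_int n) else 0)"

lemma log_wave_seq_le_1: "\<bar>log_wave_seq n\<bar> \<le> 1"
proof (cases "1 \<le> n")
  case True
  then have "0 \<le> log 2 (real_of_int n)" by simp
  then have "1 / (1 + log 2 (real_of_int n)) \<le> 1" by simp
  then show ?thesis
    using abs_log_wave_le[of "real_of_int n"] True by (simp add: log_wave_seq_def)
qed (simp add: log_wave_seq_def)

text \<open>The filter \<open>filtercomap abs at_top\<close> expresses |n| -> infinity. The
  logarithmic bound from the positive side holds trivially on the negative side, where the sequence
  is 0.\<close>

lemma log_wave_seq_tendsto_0: "(log_wave_seq \<longlongrightarrow> 0) (filtercomap abs at_top)"
proof (rule tendsto_rabs_zero_cancel,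
    rule tendsto_sandwich[where f = "\<lambda>_. 0" and h = "\<lambda>n. 1 / (1 + log 2 (real_of_int \<bar>n\<bar>))"])
  have "((\<lambda>x. 1 / (1 + log 2 x)) \<longlongrightarrow> 0) at_top" by real_asymp
  moreover have "filterlim (\<lambda>n. real_of_int \<bar>n\<bar>) at_top (filtercomap abs at_top)"
    by (intro filterlim_compose[OF filterlim_real_of_int_at_top] filterlim_filtercomap)
  ultimately show "((\<lambda>n. 1 / (1 + log 2 (real_of_int \<bar>n\<bar>))) \<longlongrightarrow> 0) (filtercomap abs at_top)"
    by (rule filterlim_compose)
  have "\<bar>log_wave_seq n\<bar> \<le> 1 / (1 + log 2 (real_of_int \<bar>n\<bar>))" if "1 \<le> \<bar>n\<bar>" for n
  proof (cases "1 \<le> n")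
    case True
    then show ?thesis using abs_log_wave_le[of "real_of_int n"] by (simp add: log_wave_seq_def)
  next
    case False
    have "0 \<le> log 2 (real_of_int \<bar>n\<bar>)" using that by simp
    then show ?thesis using False by (simp add: log_wave_seq_def)
  qed
  then show "eventually (\<lambda>n. \<bar>log_wave_seq n\<bar> \<le> 1 / (1 + log 2 (real_of_int \<bar>n\<bar>))) (filtercomap abs at_top)"
    unfolding eventually_filtercomap_at_top_linorder by blast
qed auto

lemma log_wave_seq_differences:
  obtains C where "\<And>n. \<bar>real_of_int n * (log_wave_seq n - log_wave_seq (n - 1))\<bar> \<le> C"
    and "\<And>n. \<bar>(real_of_int n)\<^sup>2 * (log_wave_seq n - 2 * log_wave_seq (n - 1) + log_wave_seq (n - 2))\<bar> \<le> C"
proof -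
  obtain C where C: "\<And>x. 2 \<le> x \<Longrightarrow> \<bar>x * (log_wave x - log_wave (x - 1))\<bar> \<le> C"
    "\<And>x. 3 \<le> x \<Longrightarrow> \<bar>x\<^sup>2 * (log_wave x - 2 * log_wave (x - 1) + log_wave (x - 2))\<bar> \<le> C"
    using log_wave_differences by blast
  show ?thesis
  proof (rule that)
    fix n :: int
    \<comment> \<open>For n = 1 and n = 2 the cutoff may interfere, and the bound by 1 on the values
      is used instead. The worst case is the second difference at n = 2, at most 4 * (1 + 2 + 1) =
      16.\<close>
    note b = log_wave_seq_le_1[of n] log_wave_seq_le_1[of "n - 1"] log_wave_seq_le_1[of "n - 2"]
    consider "n \<le> 0" | "n = 1" | "n = 2" | "3 \<le> n" by linarith
    then show "\<bar>real_of_int n * (log_wave_seq n - log_wave_seq (n - 1))\<bar> \<le> max C 16"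
    proof cases
      case 4
      then show ?thesis using C(1)[of "real_of_int n"] by (simp add: log_wave_seq_def)
    qed (use b in \<open>auto simp: log_wave_seq_def\<close>)
    consider "n \<le> 0" | "n = 1" | "n = 2" | "3 \<le> n" by linarith
    then show "\<bar>(real_of_int n)\<^sup>2 * (log_wave_seq n - 2 * log_wave_seq (n - 1) + log_wave_seq (n - 2))\<bar> \<le> max C 16"
    proof cases
      case 4
      then show ?thesis using C(2)[of "real_of_int n"] by (simp add: log_wave_seq_def)
    qed (use b in \<open>auto simp: log_wave_seq_def\<close>)
  qed
qed

lemma log_wave_seq_not_summable:
  assumes p: "1 \<le> (p :: nat)"
  shows "\<not> (\<lambda>n. \<bar>log_wave_seq n - log_wave_seq (n - int p)\<bar>) summable_on {0..}"
proof
  let ?d = "\<lambda>n. \<bar>log_wave_seq n - log_wave_seq (n - int p)\<bar>"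
  \<comment> \<open>Starting at 2p keeps both n and n - p among the positive multiples of p, where
    the cutoff has no effect.\<close>
  let ?h = "\<lambda>j. int (p * Suc (Suc j))"
  assume "?d summable_on {0..}"
  then have "?d summable_on range ?h"
    by (rule summable_on_subset_banach) auto
  moreover have "inj ?h" using p by (auto simp: inj_on_def)
  ultimately have "(\<lambda>j. ?d (?h j)) summable_on UNIV"
    by (simp add: summable_on_reindex o_def)
  moreover have "?d (?h j) = \<bar>log_wave (real (p * Suc (Suc j))) - log_wave (real (p * Suc j))\<bar>" for j
  proof -
    have "?h j - int p = int (p * Suc j)" by (simp add: algebra_simps)
    moreover have "log_wave_seq (int (p * Suc i)) = log_wave (real (p * Suc i))" for i
    proof -
      have "1 \<le> p * Suc i" using p by simp
      then have "1 \<le> int (p * Suc i)" by linarith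
      then show ?thesis unfolding log_wave_seq_def by (simp only: if_True of_int_of_nat_eq)
    qed
    ultimately show ?thesis by (simp only:)
  qed
  ultimately have "summable (\<lambda>j. \<bar>log_wave (real (p * Suc (Suc j))) - log_wave (real (p * Suc j))\<bar>)"
    by (simp only: summable_on_imp_summable)
  then show False using log_wave_unbounded_variation[OF p] by blast
qed

section \<open>Matrix coefficients and membership in the classes\<close>

lemma norm_axis: "norm (axis i x) = norm x"
proof -
  have "norm (axis i x) = L2_set (\<lambda>j. if j = i then norm x else 0) UNIV"
    unfolding norm_vec_def axis_def by (rule L2_set_cong) auto
  also have "\<dots> = norm x"
    by (simp add: L2_set_def if_distrib[of "\<lambda>t. t\<^sup>2"] cong: if_cong)
  finally show ?thesis .
qed

text \<open>Its real multiples are Hermitian with zero off-diagonal entries, so all conditions on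
  \<open>V0\<close> reduce to conditions on a scalar sequence.\<close>

abbreviation corner :: "complex^2^2" where "corner \<equiv> axis 1 (axis 1 1)"

lemma zero_in_class_S: "(\<lambda>_. 0) \<in> class_S \<beta> \<gamma> G"
proof -
  have "(SUP n\<in>A. 0 :: ennreal) = 0" for A :: "int set" by (cases "A = {}") (auto simp: bot_ennreal)
  then show ?thesis by (auto simp: class_S_def ell_infty_def bounded_iff)
qed

lemma zero_in_class_M1: "(\<lambda>_. 0) \<in> class_M1 \<beta> \<gamma> G"
proof -
  have "(SUP n\<in>A. 0 :: ennreal) = 0" for A :: "int set" by (cases "A = {}") (auto simp: bot_ennreal)
  then show ?thesis by (auto simp: class_M1_def ell_infty_def tau_def bounded_iff)
qed

text \<open>The other two summands are taken to be 0.\<close>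

lemma class_Q12_subset_class_sum: "W \<in> class_Q12 G \<Longrightarrow> W \<in> class_sum \<beta> \<gamma> G"
  unfolding class_sum_def using zero_in_class_S[of \<beta> \<gamma> G] zero_in_class_M1[of \<beta> \<gamma> G] by force

lemma class_Q12I:
  assumes "W \<in> ell_infty G"
    and "\<And>n. n \<in> G \<Longrightarrow> norm (real_of_int n *\<^sub>R (W n - tau G 1 W n)) \<le> C"
    and "\<And>n. n \<in> G \<Longrightarrow> norm ((real_of_int n)\<^sup>2 *\<^sub>R (W n - 2 *\<^sub>R tau G 1 W n + tau G 2 W n)) \<le> C"
  shows "W \<in> class_Q12 G"
proof -
  have "(SUP n\<in>G. ennreal (norm (real_of_int n *\<^sub>R (W n - tau G 1 W n)))) \<le> ennreal C"
    "(SUP n\<in>G. ennreal (norm ((real_of_int n)\<^sup>2 *\<^sub>R (W n - 2 *\<^sub>R tau G 1 W n + tau G 2 W n)))) \<le> ennreal C"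
    using assms by (auto intro!: SUP_least ennreal_leI)
  then show ?thesis
    unfolding class_Q12_def using assms(1) by (auto intro: le_less_trans[OF _ ennreal_less_top])
qed

theorem proposition2p22:
  fixes G :: "int set" and \<beta> \<gamma> :: real
  assumes "G \<in> {UNIV, {0..}}" and "0 < \<beta>" and "\<beta> < \<gamma>"
  shows "\<exists>V V0 V1.
    V0 \<in> ell_infty G \<and> V1 \<in> ell_infty G \<and>
    (\<forall>u\<in>ell2 G. V u = (\<lambda>n. mult_op V0 u n + right_shift G (mult_op V1 u) n
        + mult_op (adjoint_seq V1) (adjoint_op G (right_shift G) u) n)) \<and>
    compact_op G V \<and> self_adjoint_op G V \<and>
    (\<forall>n\<in>G. V1 n $ 1 $ 1 = 0 \<and> V1 n $ 1 $ 2 = 0 \<and> V1 n $ 2 $ 2 = 0) \<and>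
    (\<forall>n\<in>G. V0 n $ 1 $ 2 \<noteq> -1 \<and> V1 n $ 2 $ 1 \<noteq> 1) \<and>
    V0 = adjoint_seq V0 \<and>
    (\<forall>W\<in>{V0, V1}.
       ((\<lambda>n. norm (W n)) \<longlongrightarrow> 0) (inf (filtercomap abs at_top) (principal G)) \<and>
       W \<in> class_sum \<beta> \<gamma> G) \<and>
    \<not> (\<exists>p1 p2 :: nat. p1 \<ge> 1 \<and> p2 \<ge> 1 \<and>
        (\<forall>j::2. (\<lambda>n. restr {0..} (\<lambda>n. V0 n $ j $ j) n
             - tau {0..} p1 (restr {0..} (\<lambda>n. V0 n $ j $ j)) n) \<in> ell1 {0..} \<real>) \<and>
        (\<forall>W\<in>{V0, V1}. (\<lambda>n. restr {0..} (\<lambda>n. W n $ 2 $ 1) n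
             - tau {0..} p2 (restr {0..} (\<lambda>n. W n $ 2 $ 1)) n) \<in> ell1 {0..} UNIV))"
proof -
  define V0 where "V0 n = log_wave_seq n *\<^sub>R corner" for n
  define V1 :: "int \<Rightarrow> complex^2^2" where "V1 = (\<lambda>_. 0)"
  have norm_V0: "norm (V0 n) = \<bar>log_wave_seq n\<bar>" for n
    by (simp add: V0_def norm_axis)
  have "{0..} \<subseteq> G" using assms(1) by auto
  have V0_outside: "V0 n = 0" if "n \<notin> G" for n
  proof -
    have "n \<notin> {0..}" using that \<open>{0..} \<subseteq> G\<close> by blast
    then show ?thesis by (simp add: V0_def log_wave_seq_def)
  qed
  have V0_ell: "V0 \<in> ell_infty G"
    unfolding ell_infty_def bounded_iff using V0_outside log_wave_seq_le_1
    by (auto simp: norm_V0)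
  have V1_ell: "V1 \<in> ell_infty G" by (auto simp: V1_def ell_infty_def bounded_iff)
  have adj: "V0 = adjoint_seq V0"
    by (auto simp: V0_def adjoint_seq_def fun_eq_iff vec_eq_iff axis_def)
  have lim0: "((\<lambda>n. norm (V0 n)) \<longlongrightarrow> 0) (inf (filtercomap abs at_top) (principal G))"
    unfolding norm_V0
    by (rule tendsto_mono[OF inf_le1 tendsto_rabs_zero[OF log_wave_seq_tendsto_0]])
  \<comment> \<open>The value 0 that \<open>tau\<close> prescribes when n - p leaves
    \<open>G\<close> agrees with \<open>V0\<close> there, so the truncated shift is the plain
    one.\<close>
  have tau: "tau G p V0 n = V0 (n - int p)" if "n \<in> G" for n p
    using that V0_outside[of "n - int p"] by (simp add: tau_def)
  obtain C where C: "\<And>n. \<bar>real_of_int n * (log_wave_seq n - log_wave_seq (n - 1))\<bar> \<le> C"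
    "\<And>n. \<bar>(real_of_int n)\<^sup>2 * (log_wave_seq n - 2 * log_wave_seq (n - 1) + log_wave_seq (n - 2))\<bar> \<le> C"
    using log_wave_seq_differences by blast
  have Q0: "V0 \<in> class_Q12 G"
  proof (rule class_Q12I[OF V0_ell])
    fix n assume n: "n \<in> G"
    have "real_of_int n *\<^sub>R (V0 n - tau G 1 V0 n)
        = (real_of_int n * (log_wave_seq n - log_wave_seq (n - 1))) *\<^sub>R corner"
      unfolding tau[OF n] by (simp add: V0_def flip: scaleR_diff_left)
    then show "norm (real_of_int n *\<^sub>R (V0 n - tau G 1 V0 n)) \<le> C"
      using C(1) by (simp add: norm_axis)
    have "(real_of_int n)\<^sup>2 *\<^sub>R (V0 n - 2 *\<^sub>R tau G 1 V0 n + tau G 2 V0 n)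
        = ((real_of_int n)\<^sup>2 * (log_wave_seq n - 2 * log_wave_seq (n - 1) + log_wave_seq (n - 2))) *\<^sub>R corner"
      unfolding tau[OF n] by (simp add: V0_def flip: scaleR_diff_left scaleR_add_left)
    then show "norm ((real_of_int n)\<^sup>2 *\<^sub>R (V0 n - 2 *\<^sub>R tau G 1 V0 n + tau G 2 V0 n)) \<le> C"
      using C(2) by (simp add: norm_axis)
  qed
  have Q1: "V1 \<in> class_Q12 G"
    by (rule class_Q12I[OF V1_ell, of 0]) (simp_all add: V1_def tau_def)
  \<comment> \<open>With \<open>V1\<close> = 0 both shift terms vanish, whatever vector
    \<open>adjoint_op\<close> returns.\<close>
  have op: "mult_op V0 u = (\<lambda>n. mult_op V0 u n + right_shift G (mult_op V1 u) n
        + mult_op (adjoint_seq V1) (adjoint_op G (right_shift G) u) n)" for u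
    by (simp add: V1_def mult_op_def right_shift_def tau_def adjoint_seq_def
        flip: zero_vec_def)
  have not_ell1: "(\<lambda>n. restr {0..} (\<lambda>n. V0 n $ 1 $ 1) n
      - tau {0..} p (restr {0..} (\<lambda>n. V0 n $ 1 $ 1)) n) \<notin> ell1 {0..} \<real>" if p: "1 \<le> p" for p
  proof
    assume "(\<lambda>n. restr {0..} (\<lambda>n. V0 n $ 1 $ 1) n
      - tau {0..} p (restr {0..} (\<lambda>n. V0 n $ 1 $ 1)) n) \<in> ell1 {0..} \<real>"
    then have "(\<lambda>n. norm (restr {0..} (\<lambda>n. V0 n $ 1 $ 1) n
      - tau {0..} p (restr {0..} (\<lambda>n. V0 n $ 1 $ 1)) n)) summable_on {0..}"
      by (simp add: ell1_def)
    moreover have "norm (restr {0..} (\<lambda>n. V0 n $ 1 $ 1) n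
      - tau {0..} p (restr {0..} (\<lambda>n. V0 n $ 1 $ 1)) n) = \<bar>log_wave_seq n - log_wave_seq (n - int p)\<bar>"
      if "n \<in> {0..}" for n
    proof -
      have V0_11: "V0 m $ 1 $ 1 = of_real (log_wave_seq m)" for m
        by (simp add: V0_def axis_def of_real_def)
      \<comment> \<open>For 0 <= n < p both sides are 0, the right one by the cutoff at 1.\<close>
      have "tau {0..} p (restr {0..} (\<lambda>n. V0 n $ 1 $ 1)) n = of_real (log_wave_seq (n - int p))"
        using that by (simp add: tau_def restr_def V0_11 log_wave_seq_def)
      moreover have "restr {0..} (\<lambda>n. V0 n $ 1 $ 1) n = of_real (log_wave_seq n)"
        using that by (simp add: restr_def V0_11)
      ultimately show ?thesis by (simp flip: of_real_diff)
    qed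
    ultimately have "(\<lambda>n. \<bar>log_wave_seq n - log_wave_seq (n - int p)\<bar>) summable_on {0..}"
      by (rule summable_on_cong[THEN iffD1, rotated])
    then show False using log_wave_seq_not_summable[OF p] by blast
  qed
  show ?thesis
  proof (rule exI[of _ "mult_op V0"], rule exI[of _ V0], rule exI[of _ V1], intro conjI)
    show "\<forall>u\<in>ell2 G. mult_op V0 u = (\<lambda>n. mult_op V0 u n + right_shift G (mult_op V1 u) n
        + mult_op (adjoint_seq V1) (adjoint_op G (right_shift G) u) n)"
      using op by blast
    show "\<forall>n\<in>G. V0 n $ 1 $ 2 \<noteq> -1 \<and> V1 n $ 2 $ 1 \<noteq> 1"
      by (simp add: V0_def V1_def axis_def)
    show "\<forall>W\<in>{V0, V1}. ((\<lambda>n. norm (W n)) \<longlongrightarrow> 0) (inf (filtercomap abs at_top) (principal G)) \<and>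
       W \<in> class_sum \<beta> \<gamma> G"
      using lim0 Q0 Q1 class_Q12_subset_class_sum by (auto simp: V1_def)
    show "\<forall>n\<in>G. V1 n $ 1 $ 1 = 0 \<and> V1 n $ 1 $ 2 = 0 \<and> V1 n $ 2 $ 2 = 0"
      by (simp add: V1_def)
    show "\<not> (\<exists>p1 p2 :: nat. p1 \<ge> 1 \<and> p2 \<ge> 1 \<and>
        (\<forall>j::2. (\<lambda>n. restr {0..} (\<lambda>n. V0 n $ j $ j) n
             - tau {0..} p1 (restr {0..} (\<lambda>n. V0 n $ j $ j)) n) \<in> ell1 {0..} \<real>) \<and>
        (\<forall>W\<in>{V0, V1}. (\<lambda>n. restr {0..} (\<lambda>n. W n $ 2 $ 1) n
             - tau {0..} p2 (restr {0..} (\<lambda>n. W n $ 2 $ 1)) n) \<in> ell1 {0..} UNIV))"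
    proof (intro notI, elim exE conjE)
      fix p1 p2 :: nat
      assume p1: "1 \<le> p1" and ell1: "\<forall>j::2. (\<lambda>n. restr {0..} (\<lambda>n. V0 n $ j $ j) n
             - tau {0..} p1 (restr {0..} (\<lambda>n. V0 n $ j $ j)) n) \<in> ell1 {0..} \<real>"
      \<comment> \<open>The diagonal condition already fails at j = 1, for every
        \<open>p1\<close>.\<close>
      show False by (rule notE[OF not_ell1[OF p1] spec[OF ell1, of 1]])
    qed
  qed (fact V0_ell V1_ell adj compact_op_mult_op[OF V0_ell lim0]
      self_adjoint_mult_op[OF V0_ell adj])+
qed

end
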